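(* Let $X$ be a real Hilbert space, let $K_1,\dots,K_r\subset X$ be nonempty closed convex sets with $K:=\bigcap_{l=1}^rK_l=\emptyset$, and let $x_0\in X$. Suppose the best approximation algorithm (described in the context) started at $x_0$ with $J_i=\{1,\dots,r\}$ for all $i$ produces an infinite sequence $\{x_i\}$. Then $\{x_i\}$ has no strong cluster point, i.e. no subsequence of $\{x_i\}$ converges in norm.
   Context: $P_C$ denotes the metric projection onto a nonempty closed convex set $C$. Best approximation algorithm with $J_i=\{1,\dots,r\}$: given $x_0\in X$, for $i=1,2,\dots$ and each $j\in\{1,\dots,r\}$ set $$x_i^{(j)}=P_{K_j}(x_{i-1}),\quad a_i^{(j)}=x_{i-1}-x_i^{(j)},\quad b_i^{(j)}=\langle a_i^{(j)},x_i^{(j)}\rangle;$$ define $$F_i:=\{x\in X\mid \langle a_l^{(j)},x\rangle\leq b_l^{(j)}\text{ for all } l=1,\dots,i\text{ and } j=1,\dots,r\},$$ and set $x_i=P_{F_i}(x_0)$ (the projection of the original starting point $x_0$). The algorithm produces an infinite sequence precisely when every $F_i$ is nonempty. *)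

theory Defs
  imports "HOL-Analysis.Analysis"
begin

text \<open>Hilbert spaces are types of sort \<open>{real_inner, complete_space}\<close>. The library's
  \<open>closest_point\<close> requires \<open>heine_borel\<close>, which forces finite dimension, so the metric
  projection is defined here; it is well-defined by \<open>ex1_nearest_point\<close> below.\<close>

definition metric_proj :: "'a::metric_space set \<Rightarrow> 'a \<Rightarrow> 'a" where
  "metric_proj C x = (THE p. p \<in> C \<and> (\<forall>y\<in>C. dist x p \<le> dist x y))"

text \<open>In the next four definitions \<open>x\<close> is a sequence of iterates; everything at stage
  \<open>i \<ge> 1\<close> depends only on \<open>x 0, \<dots>, x (i - 1)\<close>.\<close>

definition inner_iterate :: "(nat \<Rightarrow> 'a::real_inner set) \<Rightarrow> (nat \<Rightarrow> 'a) \<Rightarrow> nat \<Rightarrow> nat \<Rightarrow> 'a" where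
  "inner_iterate K x i j = metric_proj (K j) (x (i - 1))"

definition cut_normal :: "(nat \<Rightarrow> 'a::real_inner set) \<Rightarrow> (nat \<Rightarrow> 'a) \<Rightarrow> nat \<Rightarrow> nat \<Rightarrow> 'a" where
  "cut_normal K x i j = x (i - 1) - inner_iterate K x i j"

definition cut_offset :: "(nat \<Rightarrow> 'a::real_inner set) \<Rightarrow> (nat \<Rightarrow> 'a) \<Rightarrow> nat \<Rightarrow> nat \<Rightarrow> real" where
  "cut_offset K x i j = inner (cut_normal K x i j) (inner_iterate K x i j)"

definition cut_polyhedron ::
  "(nat \<Rightarrow> 'a::real_inner set) \<Rightarrow> nat \<Rightarrow> (nat \<Rightarrow> 'a) \<Rightarrow> nat \<Rightarrow> 'a set" where
  "cut_polyhedron K r x i =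
     {z. \<forall>l\<in>{1..i}. \<forall>j\<in>{1..r}. inner (cut_normal K x l j) z \<le> cut_offset K x l j}"

text \<open>The algorithm started at \<open>x\<^sub>0\<close> runs forever and its iterates are \<open>x\<close>. As \<open>x i\<close> is
  determined by its predecessors, there is at most one such \<open>x\<close>.\<close>

definition best_approx_sequence ::
  "(nat \<Rightarrow> 'a::real_inner set) \<Rightarrow> nat \<Rightarrow> 'a \<Rightarrow> (nat \<Rightarrow> 'a) \<Rightarrow> bool" where
  "best_approx_sequence K r x\<^sub>0 x \<longleftrightarrow>
     x 0 = x\<^sub>0 \<and>
     (\<forall>i\<ge>1. cut_polyhedron K r x i \<noteq> {} \<and> x i = metric_proj (cut_polyhedron K r x i) x\<^sub>0)"

lemma nearly_nearest_points:
  fixes C :: "'a::real_inner set"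
  assumes "convex C" "u \<in> C" "v \<in> C" and d: "\<And>y. y \<in> C \<Longrightarrow> d \<le> dist x y" "0 \<le> d"
    and "(dist x u)\<^sup>2 \<le> d\<^sup>2 + e" "(dist x v)\<^sup>2 \<le> d\<^sup>2 + e"
  shows "(dist u v)\<^sup>2 \<le> 4 * e"
proof -
  define m where "m = (1/2) *\<^sub>R u + (1/2) *\<^sub>R v"
  have "m \<in> C"
    using assms(1-3) unfolding m_def by (intro convexD) auto
  then have "d\<^sup>2 \<le> (dist x m)\<^sup>2"
    using d by (intro power_mono) auto
  moreover have "(dist u v)\<^sup>2 = 2 * (dist x u)\<^sup>2 + 2 * (dist x v)\<^sup>2 - 4 * (dist x m)\<^sup>2"
    unfolding m_def dist_norm power2_norm_eq_inner
    by (simp add: inner_simps inner_commute algebra_simps)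
  ultimately show ?thesis
    using assms(6,7) by linarith
qed

lemma ex1_nearest_point:
  fixes C :: "'a::{real_inner, complete_space} set"
  assumes "closed C" "convex C" "C \<noteq> {}"
  shows "\<exists>!p. p \<in> C \<and> (\<forall>y\<in>C. dist x p \<le> dist x y)"
proof -
  define d where "d = infdist x C"
  have d: "\<And>y. y \<in> C \<Longrightarrow> d \<le> dist x y" "0 \<le> d"
    by (auto simp: d_def infdist_le infdist_nonneg)
  define S where "S n = C \<inter> cball x (sqrt (d\<^sup>2 + 1 / Suc n))" for n
  have S_sq: "(dist x u)\<^sup>2 \<le> d\<^sup>2 + 1 / Suc n" if "u \<in> S n" for u n
  proof -
    have "(dist x u)\<^sup>2 \<le> (sqrt (d\<^sup>2 + 1 / Suc n))\<^sup>2"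
      using that unfolding S_def by (intro power_mono) auto
    then show ?thesis by simp
  qed
  have "\<exists>p. \<forall>n. p \<in> S n"
  proof (rule decreasing_closed_nest)
    show "closed (S n)" for n
      using assms(1) by (auto simp: S_def)
    show "S n \<noteq> {}" for n
    proof -
      have "d < sqrt (d\<^sup>2 + 1 / Suc n)"
        by (rule real_less_rsqrt) simp
      then obtain y where "y \<in> C" "dist x y < sqrt (d\<^sup>2 + 1 / Suc n)"
        using assms(3) cINF_less_iff[of C "dist x"] by (auto simp: d_def infdist_def)
      then show ?thesis
        by (force simp: S_def)
    qed
    show "S n \<subseteq> S m" if "m \<le> n" for m n
      using that by (auto simp: S_def intro!: cball_trans elim!: order_trans simp: frac_le)
    show "\<exists>n. \<forall>u\<in>S n. \<forall>v\<in>S n. dist u v < e" if "0 < e" for e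
    proof -
      obtain n where n: "1 / Suc n < e\<^sup>2 / 4"
        using nat_approx_posE[of "e\<^sup>2 / 4"] \<open>0 < e\<close> by auto
      have "dist u v < e" if uv: "u \<in> S n" "v \<in> S n" for u v
      proof -
        have "(dist u v)\<^sup>2 \<le> 4 * (1 / Suc n)"
          using uv by (intro nearly_nearest_points[OF assms(2) _ _ d] S_sq) (auto simp: S_def)
        then have "(dist u v)\<^sup>2 < e\<^sup>2" using n by linarith
        then show ?thesis
          using \<open>0 < e\<close> by (auto intro: power_less_imp_less_base)
      qed
      then show ?thesis by blast
    qed
  qed blast
  then obtain p where p: "\<And>n. p \<in> S n" by blast
  have "(dist x p)\<^sup>2 \<le> d\<^sup>2"
  proof (rule field_le_epsilon)
    fix e :: real assume "0 < e"
    then obtain n where "1 / Suc n < e" using nat_approx_posE by blast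
    then show "(dist x p)\<^sup>2 \<le> d\<^sup>2 + e" using S_sq[OF p, of n] by linarith
  qed
  then have "dist x p \<le> d"
    using d(2) by (rule power2_le_imp_le)
  then have "p \<in> C \<and> (\<forall>y\<in>C. dist x p \<le> dist x y)"
    using p d(1) by (force simp: S_def)
  moreover have "u = v"
    if "u \<in> C \<and> (\<forall>y\<in>C. dist x u \<le> dist x y)" "v \<in> C \<and> (\<forall>y\<in>C. dist x v \<le> dist x y)" for u v
  proof -
    have "dist x v = dist x u" using that by (auto intro: antisym)
    then have "(dist u v)\<^sup>2 \<le> 4 * 0"
      using that by (intro nearly_nearest_points[OF assms(2), of _ _ "dist x u"]) auto
    then show ?thesis by simp
  qed
  ultimately show ?thesis by blast
qed

end

theory Submission
  imports Defs
begin

text \<open>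
  If a subsequence of the iterates converged to \<open>l\<close>, then \<open>l\<close> would lie in every \<open>K j\<close>.
  If \<open>x i\<close> is not in \<open>K j\<close>, the half-space that stage \<open>i + 1\<close> adds for the index \<open>j\<close>
  separates \<open>x i\<close> from \<open>K j\<close>: its boundary passes through the projection of \<open>x i\<close> onto
  \<open>K j\<close>, perpendicularly to the segment from \<open>x i\<close> to that projection. Cuts are never discarded, so every later iterate
  \<open>x k\<close> stays in this half-space, and hence \<open>x i\<close> is at least as far from \<open>x k\<close> as from its
  projection (\<open>dist_inner_iterate_le\<close>). Consecutive terms of a convergent subsequence come
  arbitrarily close, so along it the projections onto \<open>K j\<close> converge to the same limit
  \<open>l\<close>, and closedness of \<open>K j\<close> puts \<open>l\<close> into \<open>K j\<close>. That is impossible when the sets have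
  no common point.
\<close>

lemma metric_proj_mem:
  fixes C :: "'a::{real_inner, complete_space} set"
  assumes "closed C" "convex C" "C \<noteq> {}"
  shows "metric_proj C x \<in> C"
  using theI'[OF ex1_nearest_point[OF assms]] unfolding metric_proj_def by blast

lemma cut_polyhedron_eq_INT_halfspaces:
  "cut_polyhedron K r x i =
     (\<Inter>l\<in>{1..i}. \<Inter>j\<in>{1..r}. {z. inner (cut_normal K x l j) z \<le> cut_offset K x l j})"
  by (auto simp: cut_polyhedron_def)

lemma closed_cut_polyhedron: "closed (cut_polyhedron K r x i)"
  unfolding cut_polyhedron_eq_INT_halfspaces
  by (intro closed_INT ballI closed_halfspace_le)

lemma convex_cut_polyhedron: "convex (cut_polyhedron K r x i)"
  unfolding cut_polyhedron_eq_INT_halfspaces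
  by (intro convex_INT convex_halfspace_le)

lemma best_approx_iterate_mem_cut_polyhedron:
  fixes K :: "nat \<Rightarrow> 'a::{real_inner, complete_space} set"
  assumes "best_approx_sequence K r x\<^sub>0 x" "1 \<le> i"
  shows "x i \<in> cut_polyhedron K r x i"
  using assms metric_proj_mem[OF closed_cut_polyhedron convex_cut_polyhedron]
  unfolding best_approx_sequence_def by metis

text \<open>For \<open>u \<noteq> p\<close> the hypothesis puts \<open>z\<close> in the half-space with outer normal \<open>u - p\<close>
  through \<open>p\<close>; since \<open>p\<close> is the foot of the perpendicular from \<open>u\<close>, no point of that
  half-space is closer to \<open>u\<close>.\<close>

lemma dist_halfspace_foot_le:
  fixes u p z :: "'a::real_inner"
  assumes "inner (u - p) z \<le> inner (u - p) p"
  shows "dist u p \<le> dist u z"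
proof (cases "u = p")
  case False
  have "norm (u - p) * norm (u - p) = inner (u - p) (u - p)"
    by (simp add: dot_square_norm power2_eq_square)
  also have "\<dots> \<le> inner (u - p) (u - z)"
    using assms by (simp add: inner_diff_right)
  also have "\<dots> \<le> norm (u - p) * norm (u - z)"
    by (rule norm_cauchy_schwarz)
  finally show ?thesis
    using False by (simp add: dist_norm)
qed simp

text \<open>The cut that stage \<open>Suc i\<close> makes at the projection of \<open>x i\<close> is still in force at
  every stage \<open>k > i\<close>, which keeps \<open>x k\<close> away from \<open>x i\<close>.\<close>

lemma dist_inner_iterate_le:
  fixes K :: "nat \<Rightarrow> 'a::{real_inner, complete_space} set"
  assumes "best_approx_sequence K r x\<^sub>0 x" "j \<in> {1..r}" "i < k"
  shows "dist (x i) (inner_iterate K x (Suc i) j) \<le> dist (x i) (x k)"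
proof (rule dist_halfspace_foot_le)
  have "x k \<in> cut_polyhedron K r x k"
    using assms by (intro best_approx_iterate_mem_cut_polyhedron) auto
  then have "inner (cut_normal K x (Suc i) j) (x k) \<le> cut_offset K x (Suc i) j"
    using assms(2,3) by (auto simp: cut_polyhedron_def)
  then show "inner (x i - inner_iterate K x (Suc i) j) (x k)
      \<le> inner (x i - inner_iterate K x (Suc i) j) (inner_iterate K x (Suc i) j)"
    by (simp add: cut_normal_def cut_offset_def)
qed

lemma best_approx_cluster_point_mem:
  fixes K :: "nat \<Rightarrow> 'a::{real_inner, complete_space} set"
  assumes x: "best_approx_sequence K r x\<^sub>0 x"
    and j: "j \<in> {1..r}"
    and K: "closed (K j)" "convex (K j)" "K j \<noteq> {}"
    and \<sigma>: "strict_mono \<sigma>" and lim: "(x \<circ> \<sigma>) \<longlonglongrightarrow> l"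
  shows "l \<in> K j"
proof -
  define p where "p n = inner_iterate K x (Suc (\<sigma> n)) j" for n
  have lim': "(\<lambda>n. x (\<sigma> n)) \<longlonglongrightarrow> l"
    using lim by (simp add: o_def)
  have "(\<lambda>n. dist (x (\<sigma> n)) (x (\<sigma> (Suc n)))) \<longlonglongrightarrow> dist l l"
    by (intro tendsto_dist lim' LIMSEQ_Suc[OF lim'])
  then have gap: "(\<lambda>n. dist (x (\<sigma> n)) (x (\<sigma> (Suc n)))) \<longlonglongrightarrow> 0"
    by simp
  have "dist (x (\<sigma> n)) (p n) \<le> dist (x (\<sigma> n)) (x (\<sigma> (Suc n)))" for n
    unfolding p_def using \<sigma> by (intro dist_inner_iterate_le[OF x j]) (simp add: strict_mono_less)
  then have "(\<lambda>n. dist (x (\<sigma> n)) (p n)) \<longlonglongrightarrow> 0"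
    by (intro tendsto_sandwich[OF _ _ tendsto_const gap]) auto
  then have "p \<longlonglongrightarrow> l"
    by (intro Lim_transform2[OF lim']) (simp add: dist_norm tendsto_norm_zero_iff)
  moreover have "p n \<in> K j" for n
    unfolding p_def inner_iterate_def by (rule metric_proj_mem[OF K])
  ultimately show ?thesis
    using closed_sequentially[OF K(1)] by blast
qed

theorem theorem6p1:
  fixes K :: "nat \<Rightarrow> 'a::{real_inner, complete_space} set"
    and r :: nat
    and x\<^sub>0 :: 'a
    and x :: "nat \<Rightarrow> 'a"
  assumes "\<And>j. j \<in> {1..r} \<Longrightarrow> closed (K j) \<and> convex (K j) \<and> K j \<noteq> {}"
    and "(\<Inter>j\<in>{1..r}. K j) = {}"
    and "best_approx_sequence K r x\<^sub>0 x"
  shows "\<not> (\<exists>(\<sigma>::nat \<Rightarrow> nat) l. strict_mono \<sigma> \<and> (x \<circ> \<sigma>) \<longlonglongrightarrow> l)"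
proof
  assume "\<exists>(\<sigma>::nat \<Rightarrow> nat) l. strict_mono \<sigma> \<and> (x \<circ> \<sigma>) \<longlonglongrightarrow> l"
  then obtain \<sigma> :: "nat \<Rightarrow> nat" and l where "strict_mono \<sigma>" "(x \<circ> \<sigma>) \<longlonglongrightarrow> l"
    by blast
  then have "l \<in> (\<Inter>j\<in>{1..r}. K j)"
    using assms(1) best_approx_cluster_point_mem[OF assms(3)] by blast
  then show False
    using assms(2) by blast
qed

end
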